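(* Let $n\ge1$ be an integer and let $\mathcal{C}_1$ be any smooth closed loop homotopic in $\mathbb{C}\setminus\{1\}$ to the positively oriented circle centered at $1$ of some radius $R\in(0,1)$. Then for all $x=(x_1,\dots,x_n)$ sufficiently near $0$ in $\mathbb{C}^n$, $$G_n(x)=\frac{1}{(2\pi i)^n}\int_{\mathcal{C}_1^n}\prod_{j=1}^n \mathcal{S}(\bar x_j;\bar t_j)\,\frac{dt_j}{t_j},$$ where $\bar x_j=(x_j,\dots,x_n)$ and $\bar t_j=(t_j,\dots,t_n)$ for $1\le j\le n$, with $t=(t_1,\dots,t_n)$.
   Context: For $n\ge 1$, $G_n(x)=\sum_{\ell\in\mathbb{N}^n}\bigl(\frac{|\ell|!}{\ell!}\bigr)^2x^\ell$ (with $\mathbb{N}=\{0,1,2,\dots\}$, $x^\ell=x_1^{\ell_1}\cdots x_n^{\ell_n}$, $|\ell|=\ell_1+\dots+\ell_n$, $\ell!=\ell_1!\cdots\ell_n!$), a convergent power series near $0\in\mathbb{C}^n$. The functions $\mathcal{S}$ are defined recursively: for a scalar $a$, $$\mathcal{S}(a;t)=\frac{t}{(t-1)(1-at)},$$ and for $m\ge2$, $$\mathcal{S}(a_1,\dots,a_m;t_1,\dots,t_m)=\mathcal{S}\bigl(\mathcal{S}(a_m;t_m)\,a_1,\dots,\mathcal{S}(a_m;t_m)\,a_{m-1};\,t_1,\dots,t_{m-1}\bigr).$$ (These formulas also make sense when some of the $a_j$ vanish.) "Sufficiently near $0$" is relative to the chosen loop $\mathcal{C}_1$. The integrand $\mathcal{S}(\bar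 x_j;\bar t_j)/t_j$ is understood with the common factor $t_j$ cancelled. *)

theory Defs
  imports "HOL-Complex_Analysis.Complex_Analysis"
begin

text \<open>
  Points of \<open>\<complex>\<^sup>n\<close> and multi-indices in \<open>\<nat>\<^sup>n\<close> are functions on \<open>nat\<close> of which only the values
  at \<open>1, \<dots>, n\<close> matter; multi-indices are extensional on \<open>{1..n}\<close>, so that each one is
  counted exactly once.
\<close>

definition G_term :: "nat \<Rightarrow> (nat \<Rightarrow> complex) \<Rightarrow> (nat \<Rightarrow> nat) \<Rightarrow> complex" where
  "G_term n x l = (fact (\<Sum>i=1..n. l i) / (\<Prod>i=1..n. fact (l i)))\<^sup>2 * (\<Prod>i=1..n. x i ^ l i)"

definition multi_indices :: "nat \<Rightarrow> (nat \<Rightarrow> nat) set" where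
  "multi_indices n = {1..n} \<rightarrow>\<^sub>E UNIV"

definition G :: "nat \<Rightarrow> (nat \<Rightarrow> complex) \<Rightarrow> complex" where
  "G n x = (\<Sum>\<^sub>\<infinity>l\<in>multi_indices n. G_term n x l)"

definition S1 :: "complex \<Rightarrow> complex \<Rightarrow> complex" where
  "S1 a t = t / ((t - 1) * (1 - a * t))"

text \<open>\<open>S m a t\<close> is \<open>\<S>(a\<^sub>1, \<dots>, a\<^sub>m; t\<^sub>1, \<dots>, t\<^sub>m)\<close>; it is only meaningful for \<open>m \<ge> 1\<close>.\<close>

fun S :: "nat \<Rightarrow> (nat \<Rightarrow> complex) \<Rightarrow> (nat \<Rightarrow> complex) \<Rightarrow> complex" where
  "S (Suc 0) a t = S1 (a 1) (t 1)"
| "S (Suc (Suc m)) a t = S (Suc m) (\<lambda>i. S1 (a (Suc (Suc m))) (t (Suc (Suc m))) * a i) t"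

text \<open>
  \<open>S_cancelled m a t\<close> is \<open>\<S>(a\<^sub>1, \<dots>, a\<^sub>m; t\<^sub>1, \<dots>, t\<^sub>m) / t\<^sub>1\<close> with the common factor \<open>t\<^sub>1\<close> cancelled:
  the recursion ends in \<open>\<S>(c; t\<^sub>1) = t\<^sub>1 / ((t\<^sub>1 - 1) (1 - c t\<^sub>1))\<close> with \<open>c\<close> independent of \<open>t\<^sub>1\<close>.
  A loop homotopic to the circle in \<open>\<complex> - {1}\<close> may pass through \<open>0\<close>, where the literal
  quotient would be \<open>0 / 0 = 0\<close>.
\<close>

fun S_cancelled :: "nat \<Rightarrow> (nat \<Rightarrow> complex) \<Rightarrow> (nat \<Rightarrow> complex) \<Rightarrow> complex" where
  "S_cancelled (Suc 0) a t = 1 / ((t 1 - 1) * (1 - a 1 * t 1))"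
| "S_cancelled (Suc (Suc m)) a t =
     S_cancelled (Suc m) (\<lambda>i. S1 (a (Suc (Suc m))) (t (Suc (Suc m))) * a i) t"

lemma S_eq_S_cancelled:
  assumes "m \<ge> 1"
  shows "S m a t = t 1 * S_cancelled m a t"
  using assms by (induction m a t rule: S.induct) (auto simp: S1_def)

lemma S_cancelled_eq_S_divide:
  assumes "m \<ge> 1" "t 1 \<noteq> 0"
  shows "S_cancelled m a t = S m a t / t 1"
  using assms by (simp add: S_eq_S_cancelled)

text \<open>The tail \<open>(x\<^sub>j, x\<^sub>j\<^sub>+\<^sub>1, \<dots>)\<close>, renumbered from \<open>1\<close> (for \<open>j \<ge> 1\<close>).\<close>

definition tail_from :: "nat \<Rightarrow> (nat \<Rightarrow> complex) \<Rightarrow> nat \<Rightarrow> complex" where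
  "tail_from j x = (\<lambda>i. x (j + i - 1))"

definition smooth_path :: "(real \<Rightarrow> complex) \<Rightarrow> bool" where
  "smooth_path \<gamma> \<longleftrightarrow> (\<exists>\<gamma>'. continuous_on {0..1} \<gamma>' \<and>
     (\<forall>s\<in>{0..1}. (\<gamma> has_vector_derivative \<gamma>' s) (at s within {0..1})))"

text \<open>
  The integral of \<open>f(t\<^sub>1, \<dots>, t\<^sub>n) dt\<^sub>1 \<dots> dt\<^sub>n\<close> over the \<open>n\<close>-fold product of the path \<open>\<gamma>\<close> with
  itself, as the integral over the cube \<open>[0,1]\<^sup>n\<close> of the pullback along \<open>t\<^sub>i = \<gamma>(s\<^sub>i)\<close>.
\<close>

definition unit_cube_measure :: "nat \<Rightarrow> (nat \<Rightarrow> real) measure" where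
  "unit_cube_measure n = (\<Pi>\<^sub>M i\<in>{1..n}. restrict_space lborel {0..1})"

definition path_power_pullback ::
    "nat \<Rightarrow> (real \<Rightarrow> complex) \<Rightarrow> ((nat \<Rightarrow> complex) \<Rightarrow> complex) \<Rightarrow> (nat \<Rightarrow> real) \<Rightarrow> complex" where
  "path_power_pullback n \<gamma> f s =
     f (\<lambda>i. \<gamma> (s i)) * (\<Prod>i=1..n. vector_derivative \<gamma> (at (s i) within {0..1}))"

definition path_power_integrable ::
    "nat \<Rightarrow> (real \<Rightarrow> complex) \<Rightarrow> ((nat \<Rightarrow> complex) \<Rightarrow> complex) \<Rightarrow> bool" where
  "path_power_integrable n \<gamma> f \<longleftrightarrow>
     integrable (unit_cube_measure n) (path_power_pullback n \<gamma> f)"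

definition path_power_integral ::
    "nat \<Rightarrow> (real \<Rightarrow> complex) \<Rightarrow> ((nat \<Rightarrow> complex) \<Rightarrow> complex) \<Rightarrow> complex" where
  "path_power_integral n \<gamma> f =
     integral\<^sup>L (unit_cube_measure n) (path_power_pullback n \<gamma> f)"

definition S_integrand :: "nat \<Rightarrow> (nat \<Rightarrow> complex) \<Rightarrow> (nat \<Rightarrow> complex) \<Rightarrow> complex" where
  "S_integrand n x t = (\<Prod>j=1..n. S_cancelled (n - j + 1) (tail_from j x) (tail_from j t))"

lemma S_integrand_eq:
  assumes "\<And>j. j \<in> {1..n} \<Longrightarrow> t j \<noteq> 0"
  shows "S_integrand n x t = (\<Prod>j=1..n. S (n - j + 1) (tail_from j x) (tail_from j t) / t j)"
  unfolding S_integrand_def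
  by (intro prod.cong) (use assms in \<open>auto simp: S_cancelled_eq_S_divide tail_from_def\<close>)

end

theory Submission
  imports Defs
begin

text \<open>
  With \<open>c = \<S>(x\<^sub>n; t\<^sub>n)\<close>, the integrand for \<open>n\<close> variables at \<open>x\<close> is the integrand for \<open>n - 1\<close>
  variables at \<open>(c x\<^sub>1, \<dots>, c x\<^sub>n\<^sub>-\<^sub>1)\<close> times \<open>1 / ((t\<^sub>n - 1) (1 - x\<^sub>n t\<^sub>n))\<close>. So by induction the
  multiple integral is a single contour integral of \<open>G\<^sub>n\<^sub>-\<^sub>1(c x\<^sub>1, \<dots>, c x\<^sub>n\<^sub>-\<^sub>1)\<close> against this factor.
  Expanding \<open>G\<^sub>n\<^sub>-\<^sub>1\<close>, the terms of total degree \<open>k\<close> pick up the factor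
  \<open>\<Sum>m. (k + m choose m)\<^sup>2 x\<^sub>n\<^sup>m\<close>, which is how the coefficients of \<open>G\<^sub>n\<close> arise from those of
  \<open>G\<^sub>n\<^sub>-\<^sub>1\<close>.
\<close>

section \<open>Recursion and measurability of the integrand\<close>

lemma S_integrand_0 [simp]: "S_integrand 0 x t = 1"
  by (simp add: S_integrand_def)

text \<open>For every \<open>j \<le> n\<close>, the recursion of \<open>S_cancelled\<close> on the
  tails starting at \<open>j\<close> first consumes the same last pair \<open>x (Suc n)\<close>,
  \<open>t (Suc n)\<close>, so all these factors undergo the same rescaling. The factor with
  \<open>j = Suc n\<close> is the base case and gives the fraction.\<close>

lemma S_integrand_Suc:
  "S_integrand (Suc n) x t =
     S_integrand n (\<lambda>i. S1 (x (Suc n)) (t (Suc n)) * x i) t *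
       (1 / ((t (Suc n) - 1) * (1 - x (Suc n) * t (Suc n))))"
proof -
  have "S_cancelled (Suc n - j + 1) (tail_from j x) (tail_from j t) =
        S_cancelled (n - j + 1) (tail_from j (\<lambda>i. S1 (x (Suc n)) (t (Suc n)) * x i)) (tail_from j t)"
    if "j \<in> {1..n}" for j
  proof -
    \<comment> \<open>The length is brought to the shape of the second equation of
      \<open>S_cancelled\<close>; after the shift in \<open>tail_from\<close>, the last entry is the
      one with index \<open>Suc n\<close>.\<close>
    have "Suc n - j + 1 = Suc (Suc (n - j))" using that by auto
    moreover have "j + Suc (Suc (n - j)) - 1 = Suc n" using that by auto
    ultimately show ?thesis by (simp add: tail_from_def)
  qed
  then show ?thesis
    by (simp add: S_integrand_def tail_from_def)
qed

text \<open>Points are functions on all of \<open>nat\<close>; this lets an update at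
  \<open>Suc n\<close> be dropped from the integrand in \<open>n\<close> variables.\<close>

lemma S_integrand_cong:
  assumes "\<And>i. i \<in> {1..n} \<Longrightarrow> x i = y i" "\<And>i. i \<in> {1..n} \<Longrightarrow> t i = u i"
  shows "S_integrand n x t = S_integrand n y u"
  using assms
proof (induction n arbitrary: x y)
  case (Suc n)
  have "S_integrand n (\<lambda>i. S1 (x (Suc n)) (t (Suc n)) * x i) t =
        S_integrand n (\<lambda>i. S1 (y (Suc n)) (u (Suc n)) * y i) u"
    by (rule Suc.IH) (use Suc.prems in auto)
  then show ?case
    using Suc.prems by (simp add: S_integrand_Suc)
qed simp

text \<open>The coefficients \<open>x\<close> are allowed to vary with \<open>s\<close>, because the
  recursion feeds \<open>t s (Suc n)\<close> into them.\<close>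

lemma borel_measurable_S_integrand:
  assumes "\<And>i. i \<in> {1..n} \<Longrightarrow> (\<lambda>s. x s i) \<in> borel_measurable M"
    and "\<And>i. i \<in> {1..n} \<Longrightarrow> (\<lambda>s. t s i) \<in> borel_measurable M"
  shows "(\<lambda>s. S_integrand n (x s) (t s)) \<in> borel_measurable M"
  using assms
proof (induction n arbitrary: x)
  case (Suc n)
  have [measurable]: "(\<lambda>s. x s (Suc n)) \<in> borel_measurable M" "(\<lambda>s. t s (Suc n)) \<in> borel_measurable M"
    using Suc.prems by auto
  have "(\<lambda>s. S_integrand n (\<lambda>i. S1 (x s (Suc n)) (t s (Suc n)) * x s i) (t s)) \<in> borel_measurable M"
    by (rule Suc.IH) (use Suc.prems in \<open>auto simp: S1_def intro!: borel_measurable_times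
      borel_measurable_divide borel_measurable_diff\<close>)
  then show ?case
    by (simp add: S_integrand_Suc)
qed simp

section \<open>The power series \<open>G\<close>: convergence and summation over the last
  exponent\<close>

lemma G_term_scale:
  "G_term n (\<lambda>i. c * x i) l = c ^ (\<Sum>i=1..n. l i) * G_term n x l"
  by (simp add: G_term_def power_mult_distrib prod.distrib power_sum)

lemma G_term_mono:
  assumes "\<And>i. i \<in> {1..n} \<Longrightarrow> norm (x i) \<le> norm (y i)"
  shows "norm (G_term n x l) \<le> norm (G_term n y l)"
  unfolding G_term_def norm_mult prod_norm[symmetric] norm_power
  by (intro mult_left_mono prod_mono conjI power_mono) (use assms in auto)

text \<open>With k the total degree of \<open>l\<close>, the multinomial coefficient factors as (k +
  m)! / (l! m!) = (k! / l!) * (k + m choose m).\<close>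

lemma G_term_Suc:
  "G_term (Suc n) x (l(Suc n := m)) =
     G_term n x l * (of_nat ((\<Sum>i=1..n. l i) + m choose m))\<^sup>2 * x (Suc n) ^ m"
proof -
  have "(\<Sum>i=1..n. (l(Suc n := m)) i) = (\<Sum>i=1..n. l i)"
    "(\<Prod>i=1..n. fact ((l(Suc n := m)) i)) = (\<Prod>i=1..n. fact (l i) :: complex)"
    "(\<Prod>i=1..n. x i ^ ((l(Suc n := m)) i)) = (\<Prod>i=1..n. x i ^ l i)"
    by (auto intro!: sum.cong prod.cong)
  moreover have "(of_nat ((\<Sum>i=1..n. l i) + m choose m) :: complex) =
      fact ((\<Sum>i=1..n. l i) + m) / (fact m * fact (\<Sum>i=1..n. l i))"
    by (simp add: binomial_fact)
  ultimately show ?thesis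
    by (simp add: G_term_def power_divide power_mult_distrib)
qed

lemma bij_betw_multi_indices_Suc:
  "bij_betw (\<lambda>(l, m). l(Suc n := m)) (multi_indices n \<times> UNIV) (multi_indices (Suc n))"
proof -
  have *: "multi_indices (Suc n) = (\<lambda>(m, l). l(Suc n := m)) ` (UNIV \<times> multi_indices n)"
    by (simp add: multi_indices_def atLeastAtMostSuc_conv PiE_insert_eq)
  have "inj_on (\<lambda>(l, m). l(Suc n := m)) (multi_indices n \<times> UNIV)"
  proof (rule inj_onI, clarify)
    fix l m l' m' assume l: "l \<in> multi_indices n" "l' \<in> multi_indices n"
      and eq: "l(Suc n := m) = l'(Suc n := m')"
    have "l i = l' i" for i
    proof (cases "i = Suc n")
      \<comment> \<open>Here \<open>i\<close> lies outside \<open>{1..n}\<close>, so both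
        multi-indices take the default value \<open>undefined\<close> at \<open>i\<close>.\<close>
      case True
      then show ?thesis using l by (auto simp: multi_indices_def PiE_def extensional_def)
    next
      case False
      then show ?thesis using fun_cong[OF eq, of i] by simp
    qed
    then show "l = l' \<and> m = m'" using fun_cong[OF eq, of "Suc n"] by auto
  qed
  moreover have "(\<lambda>(l, m). l(Suc n := m)) ` (multi_indices n \<times> UNIV) = multi_indices (Suc n)"
    unfolding * by (force simp: image_iff)
  ultimately show ?thesis by (simp add: bij_betw_def)
qed

lemma multi_indices_0: "multi_indices 0 = {\<lambda>_. undefined}"
  by (simp add: multi_indices_def)

lemma G_term_0 [simp]: "G_term 0 x l = 1"
  by (simp add: G_term_def)

lemma G_0 [simp]: "G 0 x = 1"
  by (simp add: G_def multi_indices_0)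

lemma norm_summable_on_Times_mult:
  fixes f :: "'a \<Rightarrow> complex" and g :: "'b \<Rightarrow> complex"
  assumes "(\<lambda>x. norm (f x)) summable_on A" "(\<lambda>y. norm (g y)) summable_on B"
  shows "(\<lambda>p. norm (case p of (x, y) \<Rightarrow> f x * g y)) summable_on A \<times> B"
  unfolding Infinite_Sum.abs_summable_on_Sigma_iff
proof (intro conjI ballI)
  show "(\<lambda>y. norm (case (x, y) of (x, y) \<Rightarrow> f x * g y)) summable_on B" for x
    using assms(2) by (simp add: norm_mult summable_on_cmult_right)
  have "(\<lambda>x. norm (norm (f x) * (\<Sum>\<^sub>\<infinity>y\<in>B. norm (g y)))) summable_on A"
    using summable_on_cmult_left[OF assms(1)]
    by (simp add: abs_mult infsum_nonneg)
  then show "(\<lambda>x. norm (\<Sum>\<^sub>\<infinity>y\<in>B. norm (case (x, y) of (x, y) \<Rightarrow> f x * g y))) summable_on A"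
    by (simp add: norm_mult infsum_cmult_right')
qed

text \<open>The crude bound (k + m choose m)^2 \<le> 4^k 4^m is enough. The factor 4^k is absorbed
  by multiplying the first \<open>n\<close> variables by 4, which is why the radius shrinks by 4
  with each variable; the factor 4^m leaves a geometric series in
  \<open>4 * x (Suc n)\<close>.\<close>

lemma summable_on_G_term:
  assumes "\<And>i. i \<in> {1..n} \<Longrightarrow> norm (x i) < (1 / 4) ^ n"
  shows "G_term n x summable_on multi_indices n"
  using assms
proof (induction n arbitrary: x)
  case 0
  then show ?case by (simp add: multi_indices_0)
next
  case (Suc n)
  have "G_term n (\<lambda>i. 4 * x i) summable_on multi_indices n"
  proof (rule Suc.IH)
    fix i assume "i \<in> {1..n}"
    then show "norm (4 * x i) < (1 / 4) ^ n" using Suc.prems[of i] by (auto simp: norm_mult)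
  qed
  then have 1: "(\<lambda>l. norm (G_term n (\<lambda>i. 4 * x i) l)) summable_on multi_indices n"
    by (simp add: summable_on_iff_abs_summable_on_complex)
  have "norm (x (Suc n)) < (1 / 4) * (1 / 4) ^ n" using Suc.prems[of "Suc n"] by simp
  also have "\<dots> \<le> 1 / 4 * 1" by (intro mult_left_mono power_le_one) auto
  finally have "norm (4 * x (Suc n)) < 1" by (simp add: norm_mult)
  then have "summable (\<lambda>m. norm ((4 * x (Suc n)) ^ m))"
    unfolding norm_power by (intro summable_geometric) auto
  then have 2: "(\<lambda>m. norm ((4 * x (Suc n)) ^ m)) summable_on UNIV"
    by (subst summable_on_UNIV_nonneg_real_iff) auto
  have "(\<lambda>p. norm (case p of (l, m) \<Rightarrow> G_term (Suc n) x (l(Suc n := m)))) summable_on multi_indices n \<times> UNIV"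
  proof (rule Infinite_Sum.abs_summable_on_comparison_test[OF norm_summable_on_Times_mult[OF 1 2]], clarify)
    fix l :: "nat \<Rightarrow> nat" and m :: nat
    let ?k = "\<Sum>i=1..n. l i"
    have "real (?k + m choose m) \<le> 2 ^ (?k + m)"
      by (simp add: binomial_le_pow2)
    then have "real (?k + m choose m) ^ 2 \<le> (2 ^ (?k + m)) ^ 2"
      by (intro power_mono) auto
    also have "\<dots> = 4 ^ ?k * 4 ^ m"
      by (simp add: power2_eq_square flip: power_mult_distrib power_add)
    finally have "norm (G_term n x l) * real (?k + m choose m) ^ 2 * norm (x (Suc n)) ^ m
        \<le> norm (G_term n x l) * (4 ^ ?k * 4 ^ m) * norm (x (Suc n)) ^ m"
      by (intro mult_right_mono mult_left_mono) auto
    then show "norm (G_term (Suc n) x (l(Suc n := m))) \<le>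
          norm (G_term n (\<lambda>i. 4 * x i) l * (4 * x (Suc n)) ^ m)"
      unfolding G_term_scale by (simp add: G_term_Suc norm_mult norm_power power_mult_distrib mult_ac)
  qed
  then have "(\<lambda>p. G_term (Suc n) x ((\<lambda>(l, m). l(Suc n := m)) p)) summable_on multi_indices n \<times> UNIV"
    by (simp add: summable_on_iff_abs_summable_on_complex case_prod_unfold)
  then show ?case
    using summable_on_reindex_bij_betw[OF bij_betw_multi_indices_Suc] by blast
qed

text \<open>Unconditional summability over pairs \<open>(l, m)\<close> allows summing over the last
  exponent \<open>m\<close> first, for each fixed \<open>l\<close>.\<close>

lemma G_Suc:
  assumes "\<And>i. i \<in> {1..Suc n} \<Longrightarrow> norm (x i) < (1 / 4) ^ Suc n"
  shows "G (Suc n) x = (\<Sum>\<^sub>\<infinity>l\<in>multi_indices n. G_term n x l *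
           (\<Sum>\<^sub>\<infinity>m. (of_nat ((\<Sum>i=1..n. l i) + m choose m))\<^sup>2 * x (Suc n) ^ m))"
proof -
  let ?h = "\<lambda>(l, m). l(Suc n := m)"
  have "G_term (Suc n) x summable_on multi_indices (Suc n)"
    using assms by (rule summable_on_G_term)
  then have sm: "(\<lambda>p. G_term (Suc n) x (?h p)) summable_on multi_indices n \<times> UNIV"
    by (rule iffD2[OF summable_on_reindex_bij_betw[OF bij_betw_multi_indices_Suc]])
  have "G (Suc n) x = infsum (\<lambda>p. G_term (Suc n) x (?h p)) (multi_indices n \<times> UNIV)"
    unfolding G_def by (rule infsum_reindex_bij_betw[OF bij_betw_multi_indices_Suc, symmetric])
  also have "\<dots> = (\<Sum>\<^sub>\<infinity>l\<in>multi_indices n. \<Sum>\<^sub>\<infinity>m. G_term (Suc n) x (?h (l, m)))"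
    by (rule infsum_Sigma_banach[OF sm, symmetric])
  finally show ?thesis
    by (simp add: G_term_Suc infsum_cmult_right' mult.assoc)
qed

text \<open>This is the generalized binomial series with exponent -(k + 1) at -z, since (-1)^m times
  (-(k + 1) choose m) equals (k + m choose m).\<close>

lemma negative_binomial_has_sum:
  fixes z :: complex
  assumes "norm z < 1"
  shows "((\<lambda>m. of_nat (k + m choose m) * z ^ m) has_sum 1 / (1 - z) ^ Suc k) UNIV"
    and "(\<lambda>m. norm (of_nat (k + m choose m) * z ^ m)) summable_on UNIV"
proof -
  have coeff: "((- of_nat (Suc k) :: complex) gchoose m) * (- w) ^ m = of_nat (k + m choose m) * w ^ m" for m w
  proof -
    have "(of_nat k + of_nat m :: complex) gchoose m = (- 1) ^ m * (- (of_nat k + 1) gchoose m)"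
      by (rule gbinomial_minus')
    moreover have "(of_nat k + of_nat m :: complex) gchoose m = of_nat (k + m choose m)"
      by (metis binomial_gbinomial of_nat_add)
    ultimately show ?thesis
      by (simp add: power_minus[of w] add.commute)
  qed
  have sums: "(\<lambda>m. of_nat (k + m choose m) * w ^ m) sums (1 - w) powr (- of_nat (Suc k))"
    if "norm w < 1" for w :: complex
    using gen_binomial_complex[of "- w" "- of_nat (Suc k)"] that by (simp only: coeff) simp
  \<comment> \<open>Convergence at the larger radius \<open>r\<close> gives absolute convergence at
    \<open>z\<close>.\<close>
  obtain r where r: "norm z < r" "r < 1" using dense[OF assms] by blast
  then have "r \<ge> 0" using norm_ge_zero[of z] by linarith
  have "summable (\<lambda>m. of_nat (k + m choose m) * (of_real r :: complex) ^ m)"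
    by (rule sums_summable, rule sums) (use r \<open>r \<ge> 0\<close> in auto)
  then have "summable (\<lambda>m. norm (of_nat (k + m choose m) * z ^ m))"
    by (rule powser_insidea) (use r \<open>r \<ge> 0\<close> in auto)
  moreover have "z \<noteq> 1" using assms by auto
  then have "(1 - z) powr (- of_nat (Suc k)) = 1 / (1 - z) ^ Suc k"
    by (simp add: powr_minus powr_nat' field_simps del: of_nat_Suc power_Suc)
  ultimately show "((\<lambda>m. of_nat (k + m choose m) * z ^ m) has_sum 1 / (1 - z) ^ Suc k) UNIV"
    "(\<lambda>m. norm (of_nat (k + m choose m) * z ^ m)) summable_on UNIV"
    using norm_summable_imp_has_sum[OF _ sums[OF assms]]
    by (auto simp: summable_on_UNIV_nonneg_real_iff)
qed

section \<open>Fubini on a finite product\<close>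

text \<open>The inserted coordinate is integrated last. This order fits the recursion, where the
  last variable is a parameter of the integrand in the remaining ones.\<close>

lemma (in product_sigma_finite) product_integral_insert_rev:
  fixes f :: "_ \<Rightarrow> _::{banach, second_countable_topology}"
  assumes I: "finite I" "i \<notin> I"
    and f: "integrable (Pi\<^sub>M (insert i I) M) f"
  shows "integrable (M i) (\<lambda>y. \<integral>x. f (x(i:=y)) \<partial>Pi\<^sub>M I M)" (is "integrable _ ?g")
    and "integral\<^sup>L (Pi\<^sub>M (insert i I) M) f = (\<integral>y. (\<integral>x. f (x(i:=y)) \<partial>Pi\<^sub>M I M) \<partial>M i)"
proof -
  interpret I: finite_product_sigma_finite M I by standard fact
  interpret i: finite_product_sigma_finite M "{i}" by standard auto
  interpret P: pair_sigma_finite "Pi\<^sub>M {i} M" "Pi\<^sub>M I M" ..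
  have disj: "{i} \<inter> I = {}" and ins: "{i} \<union> I = insert i I"
    using I by auto
  have [measurable]: "f \<in> borel_measurable (Pi\<^sub>M (insert i I) M)"
    using f by auto
  have g: "?g \<in> borel_measurable (M i)"
    by measurable
  \<comment> \<open>Points of the product space are extensional, so outside
    \<open>insert i I\<close> both sides are \<open>undefined\<close>, and merging is the same as
    updating at \<open>i\<close>.\<close>
  have merge: "(\<integral>z. f (merge {i} I (x, z)) \<partial>Pi\<^sub>M I M) = ?g (x i)" for x
  proof (rule Bochner_Integration.integral_cong[OF refl])
    fix z assume "z \<in> space (Pi\<^sub>M I M)"
    then have "merge {i} I (x, z) = z(i := x i)"
      by (auto simp: fun_eq_iff merge_def space_PiM PiE_def extensional_def)
    then show "f (merge {i} I (x, z)) = f (z(i := x i))" by simp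
  qed
  have "integrable (Pi\<^sub>M {i} M \<Otimes>\<^sub>M Pi\<^sub>M I M) (\<lambda>p. f (merge {i} I p))"
    by (rule integrable_distr[OF measurable_merge]) (use distr_merge[OF disj _ I(1)] f in simp)
  from P.integrable_fst'[OF this] have "integrable (Pi\<^sub>M {i} M) (\<lambda>x. ?g (x i))"
    by (simp add: merge)
  then have "integrable (distr (Pi\<^sub>M {i} M) (M i) (\<lambda>x. x i)) ?g"
    by (subst integrable_distr_eq) (use g in auto)
  then show "integrable (M i) ?g"
    by (simp add: distr_singleton)
  show "integral\<^sup>L (Pi\<^sub>M (insert i I) M) f = integral\<^sup>L (M i) ?g"
    using product_integral_fold[OF disj _ I(1), of f] f
    by (simp add: merge product_integral_singleton[OF g])
qed

section \<open>Smooth paths and their derivatives\<close>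

lemma smooth_path_vector_derivative:
  assumes "smooth_path \<gamma>"
  shows "continuous_on {0..1} (\<lambda>s. vector_derivative \<gamma> (at s within {0..1}))"
    and "s \<in> {0..1} \<Longrightarrow> (\<gamma> has_vector_derivative vector_derivative \<gamma> (at s within {0..1})) (at s within {0..1})"
proof -
  obtain \<gamma>' where \<gamma>': "continuous_on {0..1} \<gamma>'"
    "\<And>s. s \<in> {0..1} \<Longrightarrow> (\<gamma> has_vector_derivative \<gamma>' s) (at s within {0..1})"
    using assms by (auto simp: smooth_path_def)
  then have eq: "vector_derivative \<gamma> (at s within {0..1}) = \<gamma>' s" if "s \<in> {0..1}" for s
    using that by (intro vector_derivative_within_closed_interval) auto
  show "continuous_on {0..1} (\<lambda>s. vector_derivative \<gamma> (at s within {0..1}))"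
    using \<gamma>'(1) eq by (metis (no_types, lifting) continuous_on_cong)
  show "s \<in> {0..1} \<Longrightarrow> (\<gamma> has_vector_derivative vector_derivative \<gamma> (at s within {0..1})) (at s within {0..1})"
    using \<gamma>'(2) eq by simp
qed

lemma smooth_path_imp_continuous_on:
  assumes "smooth_path \<gamma>"
  shows "continuous_on {0..1} \<gamma>"
  unfolding continuous_on_eq_continuous_within
  using has_vector_derivative_continuous[OF smooth_path_vector_derivative(2)[OF assms]] by blast

lemma smooth_path_has_vector_derivative_interior:
  assumes "smooth_path \<gamma>" "s \<in> {0<..<1}"
  shows "(\<gamma> has_vector_derivative vector_derivative \<gamma> (at s within {0..1})) (at s)"
proof -
  have "at s within {0..1} = at s"
    using assms(2) by (intro at_within_interior) auto
  then show ?thesis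
    using smooth_path_vector_derivative(2)[OF assms(1), of s] assms(2) by auto
qed

lemma smooth_path_imp_valid_path:
  assumes "smooth_path \<gamma>"
  shows "valid_path \<gamma>"
  unfolding valid_path_def piecewise_C1_differentiable_on_def C1_differentiable_on_def
\<comment> \<open>The endpoints are made exceptional, since only one-sided derivatives are known
  there.\<close>
proof (intro conjI exI[of _ "{0,1}"] exI[of _ "\<lambda>s. vector_derivative \<gamma> (at s within {0..1})"] ballI)
  show "continuous_on ({0..1} - {0, 1}) (\<lambda>s. vector_derivative \<gamma> (at s within {0..1}))"
    by (rule continuous_on_subset[OF smooth_path_vector_derivative(1)[OF assms]]) auto
qed (use assms in \<open>auto intro!: smooth_path_imp_continuous_on smooth_path_has_vector_derivative_interior\<close>)

text \<open>Both derivatives are bounded: the one within \<open>{0..1}\<close> enters the cube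
  integral, the two-sided one enters the uniform limit theorem for contour integrals.\<close>

lemma smooth_path_vector_derivative_bounded:
  assumes "smooth_path \<gamma>"
  obtains B where "\<And>s. s \<in> {0..1} \<Longrightarrow> norm (vector_derivative \<gamma> (at s within {0..1})) \<le> B"
    and "\<And>s. s \<in> {0..1} \<Longrightarrow> norm (vector_derivative \<gamma> (at s)) \<le> B"
proof -
  let ?V = "\<lambda>s. vector_derivative \<gamma> (at s within {0..1})" and ?W = "\<lambda>s. vector_derivative \<gamma> (at s)"
  have "compact (?V ` {0..1})"
    by (intro compact_continuous_image smooth_path_vector_derivative assms) auto
  then obtain B where B: "norm (?V s) \<le> B" if "s \<in> {0..1}" for s
    using compact_imp_bounded bounded_iff by (metis imageI)
  \<comment> \<open>At 0 and 1 the value of \<open>?W\<close> may be arbitrary, so its two norms are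
    simply added to the bound.\<close>
  have "norm (?W s) \<le> B + norm (?W 0) + norm (?W 1)" if "s \<in> {0..1}" for s
  proof -
    consider "s = 0" | "s = 1" | "s \<in> {0<..<1}" using \<open>s \<in> {0..1}\<close> by fastforce
    then show ?thesis
    proof cases
      case 3
      then have "?W s = ?V s"
        by (intro vector_derivative_at smooth_path_has_vector_derivative_interior assms)
      then show ?thesis using B[OF that] by (simp add: add_increasing2)
    qed (use order_trans[OF norm_ge_zero B[of 0]] in \<open>auto simp: add_increasing\<close>)
  qed
  then show thesis
    using B by (intro that[of "B + norm (?W 0) + norm (?W 1)"]) (auto simp: add_increasing2)
qed

section \<open>Contour integrals of series and of powers of \<open>S1\<close>\<close>

text \<open>By the Weierstrass M-test the finite partial sums converge uniformly on the path, so the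
  limit over finite subsets of \<open>I\<close> commutes with the integral.\<close>

lemma contour_integral_has_sum:
  assumes \<gamma>: "smooth_path \<gamma>"
    and int: "\<And>i. i \<in> I \<Longrightarrow> f i contour_integrable_on \<gamma>"
    and bound: "\<And>i z. i \<in> I \<Longrightarrow> z \<in> path_image \<gamma> \<Longrightarrow> norm (f i z) \<le> M i"
    and M: "M summable_on I"
    and sum: "\<And>z. z \<in> path_image \<gamma> \<Longrightarrow> ((\<lambda>i. f i z) has_sum F z) I"
  shows "F contour_integrable_on \<gamma>"
    and "((\<lambda>i. contour_integral \<gamma> (f i)) has_sum contour_integral \<gamma> F) I"
proof -
  obtain B where B: "\<And>s. s \<in> {0..1} \<Longrightarrow> norm (vector_derivative \<gamma> (at s)) \<le> B"
    using smooth_path_vector_derivative_bounded[OF \<gamma>] by blast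
  have lim: "uniform_limit (path_image \<gamma>) (\<lambda>X z. \<Sum>i\<in>X. f i z) F (finite_subsets_at_top I)"
    by (rule Weierstrass_m_test_general'[OF bound sum M])
  have fin: "\<forall>\<^sub>F X in finite_subsets_at_top I. finite X \<and> X \<subseteq> I"
    by (rule eventually_finite_subsets_at_top_weakI) auto
  then have ev: "\<forall>\<^sub>F X in finite_subsets_at_top I. (\<lambda>z. \<Sum>i\<in>X. f i z) contour_integrable_on \<gamma>"
    by eventually_elim (use int in \<open>auto intro!: contour_integrable_sum\<close>)
  note limit = contour_integral_uniform_limit[OF ev lim B smooth_path_imp_valid_path[OF \<gamma>]
      finite_subsets_at_top_neq_bot]
  show "F contour_integrable_on \<gamma>" by (rule limit(1))
  note limit(2)
  moreover have "\<forall>\<^sub>F X in finite_subsets_at_top I.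
      contour_integral \<gamma> (\<lambda>z. \<Sum>i\<in>X. f i z) = (\<Sum>i\<in>X. contour_integral \<gamma> (f i))"
    using fin by eventually_elim (use int in \<open>auto intro!: contour_integral_sum\<close>)
  ultimately show "((\<lambda>i. contour_integral \<gamma> (f i)) has_sum contour_integral \<gamma> F) I"
    unfolding has_sum_def by (rule Lim_transform_eventually)
qed

text \<open>After deformation to the circle, the Cauchy formula yields 1/k! times the k-th
  derivative of z^(k + m) at 1, which is a binomial coefficient.\<close>

lemma contour_integral_power_over_shifted_power:
  assumes "valid_path \<gamma>" "homotopic_loops (- {1}) \<gamma> (circlepath 1 R)" "0 < R"
  shows "contour_integral \<gamma> (\<lambda>z. z ^ (k + m) / (z - 1) ^ Suc k) =
           2 * of_real pi * \<i> * of_nat (k + m choose m)"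
proof -
  have "contour_integral \<gamma> (\<lambda>z. z ^ (k + m) / (z - 1) ^ Suc k) =
      contour_integral (circlepath 1 R) (\<lambda>z. z ^ (k + m) / (z - 1) ^ Suc k)"
    by (rule Cauchy_theorem_homotopic_loops[of "- {1}"]) (use assms in \<open>auto intro!: holomorphic_intros\<close>)
  also have "\<dots> = (2 * pi * \<i>) / fact k * (deriv ^^ k) (\<lambda>z. z ^ (k + m)) 1"
    by (intro contour_integral_unique Cauchy_has_contour_integral_higher_derivative_circlepath)
       (use assms in \<open>auto intro!: holomorphic_intros continuous_intros\<close>)
  also have "(deriv ^^ k) (\<lambda>z. z ^ (k + m)) (1 :: complex) = pochhammer (of_nat (Suc m)) k"
    using higher_deriv_power[of k 0 "k + m" 1] by (simp del: of_nat_Suc)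
  \<comment> \<open>The rising factorial of 1 of length k + m is (k + m)!; it is split after its
    first m factors.\<close>
  also have "\<dots> = fact (k + m) / fact m"
    using pochhammer_product[of m "k + m" "1 :: complex"]
    by (simp add: add.commute flip: pochhammer_fact)
  finally show ?thesis
    by (simp add: binomial_fact field_simps)
qed

text \<open>
  One binomial factor comes from expanding \<open>1 / (1 - x z)\<^sup>k\<^sup>+\<^sup>1\<close>, the other from the residue at
  \<open>1\<close>.
\<close>

lemma contour_integral_S1_power:
  assumes \<gamma>: "smooth_path \<gamma>" and hom: "homotopic_loops (- {1}) \<gamma> (circlepath 1 R)" and "0 < R"
    and K: "\<And>z. z \<in> path_image \<gamma> \<Longrightarrow> norm z \<le> K" "norm x * K < 1"
    and d: "0 < d" "\<And>z. z \<in> path_image \<gamma> \<Longrightarrow> d \<le> norm (z - 1)"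
  shows "contour_integral \<gamma> (\<lambda>z. S1 x z ^ k * (1 / ((z - 1) * (1 - x * z)))) =
           2 * of_real pi * \<i> * (\<Sum>\<^sub>\<infinity>m. (of_nat (k + m choose m))\<^sup>2 * x ^ m)"
proof -
  note valid = smooth_path_imp_valid_path[OF \<gamma>]
  have one: "1 \<notin> path_image \<gamma>" using d by force
  have "0 \<le> K" using order_trans[OF norm_ge_zero K(1)[OF pathstart_in_path_image]] .
  \<comment> \<open>The m-th term of the expansion of the integrand in powers of x z, with z^m moved
    to the second factor so that its integral is already known.\<close>
  define f where "f m z = (of_nat (k + m choose m) * x ^ m) * (z ^ (k + m) / (z - 1) ^ Suc k)" for m z
  define r where "r = norm x * K"
  have "0 \<le> r" "r < 1" using K \<open>0 \<le> K\<close> by (auto simp: r_def)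
  have int: "(\<lambda>z. z ^ (k + m) / (z - 1) ^ Suc k) contour_integrable_on \<gamma>" for m
    by (rule contour_integrable_holomorphic_simple[of _ "- {1}"])
       (use valid one in \<open>auto intro!: holomorphic_intros\<close>)
  have "((\<lambda>m. contour_integral \<gamma> (f m)) has_sum
      contour_integral \<gamma> (\<lambda>z. S1 x z ^ k * (1 / ((z - 1) * (1 - x * z))))) UNIV"
  proof (rule contour_integral_has_sum(2)[OF \<gamma>])
    show "f m contour_integrable_on \<gamma>" for m
      unfolding f_def by (intro contour_integrable_lmul int)
    \<comment> \<open>The majorant uses |x z| \<le> r, |z| \<le> K and |z - 1| \<ge> d on the loop;
      it is the negative binomial series at \<open>r\<close> up to a constant.\<close>
    show "(\<lambda>m. norm (of_nat (k + m choose m) * of_real r ^ m :: complex) * (K ^ k / d ^ Suc k)) summable_on UNIV"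
      by (intro summable_on_cmult_left negative_binomial_has_sum(2)) (use \<open>0 \<le> r\<close> \<open>r < 1\<close> in auto)
    fix z assume z: "z \<in> path_image \<gamma>"
    have "norm (x * z) \<le> r"
      using K(1)[OF z] by (auto simp: r_def norm_mult intro: mult_left_mono)
    then have xz: "norm (x * z) < 1" using \<open>r < 1\<close> by simp
    have *: "of_nat (k + m choose m) * (x * z) ^ m * (z ^ k / (z - 1) ^ Suc k) = f m z" for m
      by (simp add: f_def power_mult_distrib power_add)
    have "((\<lambda>m. f m z) has_sum 1 / (1 - x * z) ^ Suc k * (z ^ k / (z - 1) ^ Suc k)) UNIV"
      unfolding *[symmetric] by (rule has_sum_cmult_left[OF negative_binomial_has_sum(1)[OF xz, of k]])
    \<comment> \<open>The k factors \<open>S1 x z\<close> supply z^k, and the additional weight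
      raises the power of both denominators to k + 1.\<close>
    also have "1 / (1 - x * z) ^ Suc k * (z ^ k / (z - 1) ^ Suc k) =
        S1 x z ^ k * (1 / ((z - 1) * (1 - x * z)))"
      by (simp add: S1_def power_divide power_mult_distrib mult_ac)
    finally show "((\<lambda>m. f m z) has_sum S1 x z ^ k * (1 / ((z - 1) * (1 - x * z)))) UNIV" .
    show "norm (f m z) \<le> norm (of_nat (k + m choose m) * of_real r ^ m :: complex) * (K ^ k / d ^ Suc k)" for m
    proof -
      have "norm (f m z) = real (k + m choose m) * (norm (x * z) ^ m * (norm z ^ k / norm (z - 1) ^ Suc k))"
        by (simp add: *[symmetric] norm_mult norm_divide norm_power del: power_Suc)
      also have "\<dots> \<le> real (k + m choose m) * (r ^ m * (K ^ k / d ^ Suc k))"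
        by (intro mult_left_mono mult_mono power_mono frac_le)
           (use K(1)[OF z] d(2)[OF z] d(1) \<open>norm (x * z) \<le> r\<close> \<open>0 \<le> r\<close> \<open>0 \<le> K\<close> in auto)
      finally show ?thesis using \<open>0 \<le> r\<close> by (simp add: norm_mult norm_power)
    qed
  qed
  moreover have "contour_integral \<gamma> (f m) =
      2 * of_real pi * \<i> * ((of_nat (k + m choose m))\<^sup>2 * x ^ m)" for m
    unfolding f_def contour_integral_lmul[OF int]
      contour_integral_power_over_shifted_power[OF valid hom \<open>0 < R\<close>]
    by (simp add: power2_eq_square)
  ultimately show ?thesis
    by (simp add: infsumI flip: infsum_cmult_right')
qed

section \<open>Integrals over the cube and their reduction to contour integrals\<close>

abbreviation unit_interval_measure :: "real measure" where
  "unit_interval_measure \<equiv> restrict_space lborel {0..1}"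

lemma product_sigma_finite_unit_interval: "product_sigma_finite (\<lambda>_. unit_interval_measure)"
  by standard (intro sigma_finite_measure.sigma_finite_countable sigma_finite_measure_restrict_space
    sigma_finite_lborel, simp)

lemma finite_measure_unit_cube: "finite_measure (unit_cube_measure n)"
proof -
  interpret product_sigma_finite "\<lambda>_ :: nat. unit_interval_measure"
    by (rule product_sigma_finite_unit_interval)
  have "emeasure (unit_cube_measure n) (space (unit_cube_measure n)) =
      (\<Prod>i\<in>{1..n}. emeasure unit_interval_measure (space unit_interval_measure))"
    unfolding unit_cube_measure_def space_PiM by (rule emeasure_PiM) (rule finite_atLeastAtMost, rule sets.top)
  also have "\<dots> = 1"
    by (simp add: emeasure_restrict_space space_restrict_space)
  finally show ?thesis by (intro finite_measureI) simp
qed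

text \<open>A contour integral is a gauge integral over \<open>{0..1}\<close>, which agrees with the
  Lebesgue integral once the latter is known to exist.\<close>

lemma integral_unit_interval_eq_contour_integral:
  assumes "integrable unit_interval_measure (\<lambda>s. f (\<gamma> s) * vector_derivative \<gamma> (at s within {0..1}))"
  shows "(\<integral>s. f (\<gamma> s) * vector_derivative \<gamma> (at s within {0..1}) \<partial>unit_interval_measure) =
           contour_integral \<gamma> f"
proof -
  have "set_integrable lborel {0..1} (\<lambda>s. f (\<gamma> s) * vector_derivative \<gamma> (at s within {0..1}))"
    using assms by (simp add: integrable_restrict_space set_integrable_def)
  from set_borel_integral_eq_integral[OF this]
  have "((\<lambda>s. f (\<gamma> s) * vector_derivative \<gamma> (at s within {0..1})) has_integral
      (\<integral>s. f (\<gamma> s) * vector_derivative \<gamma> (at s within {0..1}) \<partial>unit_interval_measure)) {0..1}"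
    by (simp add: integral_restrict_space set_lebesgue_integral_def has_integral_iff)
  then show ?thesis
    by (metis contour_integral_unique has_contour_integral_def)
qed

text \<open>The pullback is measurable and bounded, and the cube has finite measure.\<close>

lemma path_power_integrable_S_integrand:
  assumes \<gamma>: "smooth_path \<gamma>"
    and B: "\<And>s. (\<And>i. i \<in> {1..n} \<Longrightarrow> s i \<in> {0..1}) \<Longrightarrow> norm (S_integrand n x (\<lambda>i. \<gamma> (s i))) \<le> B"
  shows "path_power_integrable n \<gamma> (S_integrand n x)"
proof -
  let ?V = "\<lambda>s. vector_derivative \<gamma> (at s within {0..1})"
  interpret P: finite_measure "unit_cube_measure n"
    by (rule finite_measure_unit_cube)
  \<comment> \<open>This makes functions continuous on \<open>{0..1}\<close> measurable for the
    restricted \<open>lborel\<close>.\<close>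
  have sets_eq: "sets unit_interval_measure = sets (restrict_space borel {0..1})"
    by (intro sets_restrict_space_cong) simp
  have [measurable]: "\<gamma> \<in> borel_measurable unit_interval_measure" "?V \<in> borel_measurable unit_interval_measure"
    using \<gamma> by (auto intro!: borel_measurable_continuous_on_restrict smooth_path_imp_continuous_on
      smooth_path_vector_derivative simp: measurable_cong_sets[OF sets_eq refl])
  have meas: "(\<lambda>s. h (s i)) \<in> borel_measurable (unit_cube_measure n)"
    if "h \<in> borel_measurable unit_interval_measure" "i \<in> {1..n}" for h :: "real \<Rightarrow> complex" and i
    unfolding unit_cube_measure_def
    using that by measurable
  obtain D where D: "\<And>s. s \<in> {0..1} \<Longrightarrow> norm (?V s) \<le> D"
    using smooth_path_vector_derivative_bounded[OF \<gamma>] by blast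
  have "integrable (unit_cube_measure n) (path_power_pullback n \<gamma> (S_integrand n x))"
  proof (rule P.integrable_const_bound[where B = "B * D ^ n"])
    show "path_power_pullback n \<gamma> (S_integrand n x) \<in> borel_measurable (unit_cube_measure n)"
      unfolding path_power_pullback_def
      by (intro borel_measurable_times borel_measurable_prod borel_measurable_S_integrand meas) auto
    show "AE s in unit_cube_measure n. norm (path_power_pullback n \<gamma> (S_integrand n x) s) \<le> B * D ^ n"
    proof (rule AE_I2)
      fix s assume "s \<in> space (unit_cube_measure n)"
      then have s: "s i \<in> {0..1}" if "i \<in> {1..n}" for i
        using that by (auto simp: unit_cube_measure_def space_PiM space_restrict_space)
      have "norm (\<Prod>i=1..n. ?V (s i)) \<le> (\<Prod>i=1..n. D)"
        unfolding prod_norm[symmetric] using s D by (intro prod_mono) auto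
      then show "norm (path_power_pullback n \<gamma> (S_integrand n x) s) \<le> B * D ^ n"
        using B[OF s] order_trans[OF norm_ge_zero B[OF s]]
        by (auto simp: path_power_pullback_def norm_mult intro!: mult_mono)
    qed
  qed
  then show ?thesis by (simp add: path_power_integrable_def)
qed

lemma path_power_integral_0 [simp]: "path_power_integral 0 \<gamma> (\<lambda>_. 1) = 1"
  by (simp add: path_power_integral_def path_power_pullback_def unit_cube_measure_def PiM_empty
    lebesgue_integral_count_space_finite)

lemma path_power_pullback_Suc:
  "path_power_pullback (Suc n) \<gamma> (S_integrand (Suc n) x) (s(Suc n := y)) =
     path_power_pullback n \<gamma> (S_integrand n (\<lambda>i. S1 (x (Suc n)) (\<gamma> y) * x i)) s *
       (1 / ((\<gamma> y - 1) * (1 - x (Suc n) * \<gamma> y)) * vector_derivative \<gamma> (at y within {0..1}))"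
proof -
  have "S_integrand n (\<lambda>i. S1 (x (Suc n)) (\<gamma> y) * x i) (\<lambda>i. \<gamma> ((s(Suc n := y)) i)) =
        S_integrand n (\<lambda>i. S1 (x (Suc n)) (\<gamma> y) * x i) (\<lambda>i. \<gamma> (s i))"
    by (rule S_integrand_cong) auto
  moreover have "(\<Prod>i=1..n. vector_derivative \<gamma> (at ((s(Suc n := y)) i) within {0..1})) =
      (\<Prod>i=1..n. vector_derivative \<gamma> (at (s i) within {0..1}))"
    by (rule prod.cong) auto
  ultimately show ?thesis
    unfolding path_power_pullback_def S_integrand_Suc by (simp add: mult_ac)
qed

text \<open>Fubini with the last variable outermost; the inner integral has to be known only for
  values \<open>z\<close> on the loop.\<close>

lemma path_power_integral_Suc:
  assumes "path_power_integrable (Suc n) \<gamma> (S_integrand (Suc n) x)"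
    and H: "\<And>z. z \<in> path_image \<gamma> \<Longrightarrow>
           path_power_integral n \<gamma> (S_integrand n (\<lambda>i. S1 (x (Suc n)) z * x i)) = H z"
  shows "path_power_integral (Suc n) \<gamma> (S_integrand (Suc n) x) =
           contour_integral \<gamma> (\<lambda>z. H z * (1 / ((z - 1) * (1 - x (Suc n) * z))))"
proof -
  interpret product_sigma_finite "\<lambda>_ :: nat. unit_interval_measure"
    by (rule product_sigma_finite_unit_interval)
  let ?V = "\<lambda>s. vector_derivative \<gamma> (at s within {0..1})"
  let ?w = "\<lambda>z. 1 / ((z - 1) * (1 - x (Suc n) * z))"
  let ?F = "path_power_pullback (Suc n) \<gamma> (S_integrand (Suc n) x)"
  have cube: "unit_cube_measure (Suc n) = Pi\<^sub>M (insert (Suc n) {1..n}) (\<lambda>_. unit_interval_measure)"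
    by (simp add: unit_cube_measure_def atLeastAtMostSuc_conv)
  have F: "integrable (Pi\<^sub>M (insert (Suc n) {1..n}) (\<lambda>_. unit_interval_measure)) ?F"
    using assms(1) by (simp add: path_power_integrable_def cube)
  have inner: "(\<integral>s. ?F (s(Suc n := y)) \<partial>Pi\<^sub>M {1..n} (\<lambda>_. unit_interval_measure)) =
      (H (\<gamma> y) * ?w (\<gamma> y)) * ?V y" if "y \<in> {0..1}" for y
  proof -
    have "\<gamma> y \<in> path_image \<gamma>" using that by (auto simp: path_image_def)
    from H[OF this] show ?thesis
      unfolding path_power_pullback_Suc path_power_integral_def unit_cube_measure_def
      by simp
  qed
  have "integrable unit_interval_measure (\<lambda>y. (H (\<gamma> y) * ?w (\<gamma> y)) * ?V y)"
    using product_integral_insert_rev(1)[OF _ _ F]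
    by (subst Bochner_Integration.integrable_cong[OF refl inner[symmetric]])
       (auto simp: space_restrict_space)
  note contour = integral_unit_interval_eq_contour_integral[OF this]
  have "path_power_integral (Suc n) \<gamma> (S_integrand (Suc n) x) =
    (\<integral>y. \<integral>s. ?F (s(Suc n := y)) \<partial>Pi\<^sub>M {1..n} (\<lambda>_. unit_interval_measure) \<partial>unit_interval_measure)"
    unfolding path_power_integral_def cube by (rule product_integral_insert_rev(2)[OF _ _ F]) auto
  also have "\<dots> = (\<integral>y. (H (\<gamma> y) * ?w (\<gamma> y)) * ?V y \<partial>unit_interval_measure)"
    by (intro Bochner_Integration.integral_cong refl inner) (auto simp: space_restrict_space)
  also note contour
  finally show ?thesis .
qed

section \<open>Induction on the number of variables\<close>

text \<open>The bound \<open>B\<close> strengthens the induction: it provides the integrability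
  needed for Fubini. It is uniform in \<open>x\<close> because the inductive step applies it to
  arguments rescaled by a factor that varies along the loop.\<close>

lemma G_eq_path_power_integral:
  assumes \<gamma>: "smooth_path \<gamma>" and hom: "homotopic_loops (- {1}) \<gamma> (circlepath 1 R)" and "0 < R"
  shows "\<exists>\<epsilon>>0. \<exists>B. \<forall>x. (\<forall>i\<in>{1..n}. norm (x i) < \<epsilon>) \<longrightarrow>
           (\<forall>s. (\<forall>i\<in>{1..n}. s i \<in> {0..1}) \<longrightarrow> norm (S_integrand n x (\<lambda>i. \<gamma> (s i))) \<le> B) \<and>
           path_power_integral n \<gamma> (S_integrand n x) = (2 * of_real pi * \<i>) ^ n * G n x"
proof (induction n)
  case 0
  show ?case by (intro exI[of _ 1]) (auto intro: exI[of _ 1])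
next
  case (Suc n)
  then obtain \<epsilon> B where "\<epsilon> > 0"
    and B: "\<And>x s. (\<forall>i\<in>{1..n}. norm (x i) < \<epsilon>) \<Longrightarrow> (\<forall>i\<in>{1..n}. s i \<in> {0..1}) \<Longrightarrow>
               norm (S_integrand n x (\<lambda>i. \<gamma> (s i))) \<le> B"
    and IH: "\<And>x. (\<forall>i\<in>{1..n}. norm (x i) < \<epsilon>) \<Longrightarrow>
               path_power_integral n \<gamma> (S_integrand n x) = (2 * of_real pi * \<i>) ^ n * G n x"
    by meson
  note valid = smooth_path_imp_valid_path[OF \<gamma>]
  have one: "1 \<notin> path_image \<gamma>"
    using homotopic_loops_imp_subset[OF hom] by auto
  obtain d where d: "0 < d" "\<And>z. z \<in> path_image \<gamma> \<Longrightarrow> d \<le> norm (z - 1)"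
    using separate_point_closed[OF closed_valid_path_image[OF valid] one]
    by (auto simp: dist_norm norm_minus_commute)
  obtain K where K: "0 < K" "\<And>z. z \<in> path_image \<gamma> \<Longrightarrow> norm z \<le> K"
    using bounded_valid_path_image[OF valid] by (auto simp: bounded_pos)
  \<comment> \<open>A bound for the scaling factor \<open>c z\<close> on the loop: |z| \<le> K, |z -
    1| \<ge> d and, for small \<open>x\<close>, |1 - x z| \<ge> 1/2.\<close>
  define C where "C = 2 * K / d"
  have "C > 0" using d K by (simp add: C_def)
  \<comment> \<open>In order: the rescaled point meets the induction hypothesis; it lies where
    \<open>G n\<close> converges; |x z| stays below 1/2 on the loop; \<open>G (Suc n)\<close> can be
    expanded at \<open>x\<close>.\<close>
  define \<delta> where "\<delta> = Min {\<epsilon> / C, (1 / 4) ^ n / C, 1 / (2 * K), (1 / 4) ^ Suc n}"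
  have "\<delta> > 0" using \<open>\<epsilon> > 0\<close> \<open>C > 0\<close> \<open>K > 0\<close> by (simp add: \<delta>_def)
  have \<delta>: "\<delta> \<le> \<epsilon> / C" "\<delta> \<le> (1 / 4) ^ n / C" "\<delta> \<le> 1 / (2 * K)" "\<delta> \<le> (1 / 4) ^ Suc n"
    unfolding \<delta>_def by (rule Min_le; simp)+
  have "(\<forall>s. (\<forall>i\<in>{1..Suc n}. s i \<in> {0..1}) \<longrightarrow> norm (S_integrand (Suc n) x (\<lambda>i. \<gamma> (s i))) \<le> B * (2 / d)) \<and>
        path_power_integral (Suc n) \<gamma> (S_integrand (Suc n) x) = (2 * of_real pi * \<i>) ^ Suc n * G (Suc n) x"
    if x: "\<forall>i\<in>{1..Suc n}. norm (x i) < \<delta>" for x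
  proof -
    define c where "c = S1 (x (Suc n))"
    define w where "w z = 1 / ((z - 1) * (1 - x (Suc n) * z))" for z
    have xK: "norm (x (Suc n)) * K < 1 / 2"
    proof -
      have "norm (x (Suc n)) < 1 / (2 * K)" using x \<delta>(3) by force
      then show ?thesis using \<open>K > 0\<close> by (simp add: field_simps)
    qed
    have half: "1 / 2 \<le> norm (1 - x (Suc n) * z)" if "z \<in> path_image \<gamma>" for z
    proof -
      have "norm (x (Suc n) * z) \<le> norm (x (Suc n)) * K"
        using K(2)[OF that] by (simp add: norm_mult mult_left_mono)
      then show ?thesis
        using xK norm_triangle_ineq2[of 1 "x (Suc n) * z"] by simp
    qed
    have w: "norm (w z) \<le> 2 / d" if "z \<in> path_image \<gamma>" for z
    proof -
      have "d * (1 / 2) \<le> norm (z - 1) * norm (1 - x (Suc n) * z)"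
        using d(2)[OF that] half[OF that] d(1) by (intro mult_mono) auto
      then have "1 / norm ((z - 1) * (1 - x (Suc n) * z)) \<le> 1 / (d * (1 / 2))"
        using d(1) unfolding norm_mult by (intro frac_le) auto
      then show ?thesis by (simp add: w_def norm_divide)
    qed
    have c: "norm (c z) \<le> C" if "z \<in> path_image \<gamma>" for z
    proof -
      have "norm (c z) = norm z * norm (w z)" by (simp add: c_def w_def S1_def flip: norm_mult)
      also have "\<dots> \<le> K * (2 / d)"
        by (intro mult_mono K(2) w that) (use K(1) in auto)
      finally show ?thesis by (simp add: C_def mult_ac)
    qed
    have cx: "norm (c z * x i) \<le> C * norm (x i)" if "z \<in> path_image \<gamma>" for z i
      using c[OF that] by (simp add: norm_mult mult_right_mono)
    have Cx: "C * norm (x i) < \<epsilon>" "C * norm (x i) < (1 / 4) ^ n" if "i \<in> {1..n}" for i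
    proof -
      have "norm (x i) < \<delta>" using x that by auto
      with \<delta>(1,2) have "norm (x i) < \<epsilon> / C" "norm (x i) < (1 / 4) ^ n / C" by linarith+
      then show "C * norm (x i) < \<epsilon>" "C * norm (x i) < (1 / 4) ^ n"
        using \<open>C > 0\<close> by (simp_all add: field_simps)
    qed
    have small: "\<forall>i\<in>{1..n}. norm (c z * x i) < \<epsilon>" if "z \<in> path_image \<gamma>" for z
      using cx[OF that] Cx(1) by (meson order_le_less_trans)

    have bound: "norm (S_integrand (Suc n) x (\<lambda>i. \<gamma> (s i))) \<le> B * (2 / d)"
      if s: "\<forall>i\<in>{1..Suc n}. s i \<in> {0..1}" for s
    proof -
      have z: "\<gamma> (s (Suc n)) \<in> path_image \<gamma>" using s by (auto simp: path_image_def)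
      have "norm (S_integrand n (\<lambda>i. c (\<gamma> (s (Suc n))) * x i) (\<lambda>i. \<gamma> (s i))) \<le> B"
        using s by (intro B small z) auto
      then show ?thesis
        using w[OF z] order_trans[OF norm_ge_zero]
        unfolding S_integrand_Suc c_def w_def norm_mult[of "S_integrand _ _ _"]
        by (intro mult_mono) auto
    qed

    \<comment> \<open>Majorant independent of \<open>z\<close>: |c z| is replaced by
      \<open>C\<close>, and the points C |x_i| still lie in the region of summability.\<close>
    let ?M = "\<lambda>l. norm (G_term n (\<lambda>i. of_real (C * norm (x i))) l) * (2 / d)"
    \<comment> \<open>Stating the condition as \<open>1 - x (Suc n) * z \<noteq> 0\<close> also
      covers \<open>x (Suc n) = 0\<close>, where no second pole exists.\<close>
    have hol: "c holomorphic_on {z. 1 - x (Suc n) * z \<noteq> 0} - {1}"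
      "w holomorphic_on {z. 1 - x (Suc n) * z \<noteq> 0} - {1}"
      unfolding c_def w_def S1_def by (auto intro!: holomorphic_intros)
    have op: "open ({z. 1 - x (Suc n) * z \<noteq> 0} - {1})"
      by (intro open_Diff open_Collect_neq continuous_intros)
    have sub: "path_image \<gamma> \<subseteq> {z. 1 - x (Suc n) * z \<noteq> 0} - {1}"
      using one half by force
    have int: "(\<lambda>z. c z ^ k * w z) contour_integrable_on \<gamma>" for k
      by (rule contour_integrable_holomorphic_simple[OF _ op valid sub])
         (use hol in \<open>auto intro!: holomorphic_intros\<close>)
    \<comment> \<open>Homogeneity isolates the dependence on \<open>z\<close> in a power of
      \<open>c z\<close> with exponent the total degree of \<open>l\<close>.\<close>
    have term_eq: "G_term n (\<lambda>i. c z * x i) l * w z = G_term n x l * (c z ^ (\<Sum>i=1..n. l i) * w z)" for z l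
      by (simp add: G_term_scale)
    have term_int: "(\<lambda>z. G_term n (\<lambda>i. c z * x i) l * w z) contour_integrable_on \<gamma>" for l
      unfolding term_eq by (intro contour_integrable_lmul int)
    have term_bound: "norm (G_term n (\<lambda>i. c z * x i) l * w z) \<le> ?M l" if z: "z \<in> path_image \<gamma>" for l z
      unfolding norm_mult[of "G_term _ _ _"]
      by (intro mult_mono G_term_mono w z) (use cx[OF z] \<open>C > 0\<close> in \<open>auto simp: norm_mult\<close>)
    have "G_term n (\<lambda>i. of_real (C * norm (x i))) summable_on multi_indices n"
      by (rule summable_on_G_term) (use Cx(2) \<open>C > 0\<close> in \<open>auto simp: norm_mult\<close>)
    then have M: "?M summable_on multi_indices n"
      by (intro summable_on_cmult_left) (simp add: summable_on_iff_abs_summable_on_complex)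
    have term_sum: "((\<lambda>l. G_term n (\<lambda>i. c z * x i) l * w z) has_sum G n (\<lambda>i. c z * x i) * w z)
        (multi_indices n)" if z: "z \<in> path_image \<gamma>" for z
    proof -
      have "norm (c z * x i) < (1 / 4) ^ n" if "i \<in> {1..n}" for i
        using cx[OF z] Cx(2)[OF that] by (rule order_le_less_trans)
      then have "G_term n (\<lambda>i. c z * x i) summable_on multi_indices n"
        by (rule summable_on_G_term)
      then show ?thesis
        unfolding G_def by (intro has_sum_cmult_left has_sum_infsum)
    qed
    note series = contour_integral_has_sum[OF \<gamma> term_int term_bound M term_sum]
    note series(2)
    moreover have "contour_integral \<gamma> (\<lambda>z. G_term n (\<lambda>i. c z * x i) l * w z) =
        2 * of_real pi * \<i> * (G_term n x l *
          (\<Sum>\<^sub>\<infinity>m. (of_nat ((\<Sum>i=1..n. l i) + m choose m))\<^sup>2 * x (Suc n) ^ m))" for l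
      unfolding term_eq contour_integral_lmul[OF int]
      using contour_integral_S1_power[OF \<gamma> hom \<open>0 < R\<close> K(2) _ d, of "x (Suc n)" "\<Sum>i=1..n. l i"] xK
      by (simp add: c_def w_def)
    moreover have "G (Suc n) x = (\<Sum>\<^sub>\<infinity>l\<in>multi_indices n. G_term n x l *
           (\<Sum>\<^sub>\<infinity>m. (of_nat ((\<Sum>i=1..n. l i) + m choose m))\<^sup>2 * x (Suc n) ^ m))"
      by (rule G_Suc) (use x \<delta>(4) in force)
    ultimately have G: "contour_integral \<gamma> (\<lambda>z. G n (\<lambda>i. c z * x i) * w z) = 2 * of_real pi * \<i> * G (Suc n) x"
      by (simp add: has_sum_iff infsum_cmult_right')
    \<comment> \<open>The induction hypothesis evaluates the inner integral at the rescaled point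
      \<open>\<lambda>i. c z * x i\<close>, for each \<open>z\<close> on the loop.\<close>
    have "path_power_integral (Suc n) \<gamma> (S_integrand (Suc n) x) =
       contour_integral \<gamma> (\<lambda>z. (2 * of_real pi * \<i>) ^ n * G n (\<lambda>i. c z * x i) * (1 / ((z - 1) * (1 - x (Suc n) * z))))"
      by (intro path_power_integral_Suc path_power_integrable_S_integrand[OF \<gamma> bound])
         (use IH[OF small] in \<open>auto simp: c_def\<close>)
    also have "\<dots> = (2 * of_real pi * \<i>) ^ n * contour_integral \<gamma> (\<lambda>z. G n (\<lambda>i. c z * x i) * w z)"
      using contour_integral_lmul[OF series(1), of "(2 * of_real pi * \<i>) ^ n"] by (simp add: w_def mult.assoc)
    finally have "path_power_integral (Suc n) \<gamma> (S_integrand (Suc n) x) =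
        (2 * of_real pi * \<i>) ^ Suc n * G (Suc n) x"
      unfolding G by simp
    with bound show ?thesis by blast
  qed
  with \<open>\<delta> > 0\<close> show ?case by blast
qed

theorem theorem1p2:
  fixes n :: nat and \<gamma> :: "real \<Rightarrow> complex" and R :: real
  assumes "n \<ge> 1"
    and "smooth_path \<gamma>"
    and "0 < R" and "R < 1"
    and "homotopic_loops (- {1}) \<gamma> (circlepath 1 R)"
  shows "\<exists>\<epsilon>>0. \<forall>x :: nat \<Rightarrow> complex. (\<forall>i\<in>{1..n}. cmod (x i) < \<epsilon>) \<longrightarrow>
           G_term n x summable_on multi_indices n \<and>
           path_power_integrable n \<gamma> (S_integrand n x) \<and>
           G n x = 1 / (2 * of_real pi * \<i>) ^ n * path_power_integral n \<gamma> (S_integrand n x)"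
proof -
  obtain \<epsilon> B where "\<epsilon> > 0"
    and B: "\<And>x s. (\<forall>i\<in>{1..n}. norm (x i) < \<epsilon>) \<Longrightarrow> (\<forall>i\<in>{1..n}. s i \<in> {0..1}) \<Longrightarrow>
               norm (S_integrand n x (\<lambda>i. \<gamma> (s i))) \<le> B"
    and eq: "\<And>x. (\<forall>i\<in>{1..n}. norm (x i) < \<epsilon>) \<Longrightarrow>
               path_power_integral n \<gamma> (S_integrand n x) = (2 * of_real pi * \<i>) ^ n * G n x"
    using G_eq_path_power_integral[OF assms(2,5,3), of n] by meson
  \<comment> \<open>The second entry of the minimum below secures the convergence of the series
    defining \<open>G n x\<close>.\<close>
  have "G_term n x summable_on multi_indices n \<and>
        path_power_integrable n \<gamma> (S_integrand n x) \<and>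
        G n x = 1 / (2 * of_real pi * \<i>) ^ n * path_power_integral n \<gamma> (S_integrand n x)"
    if x: "\<forall>i\<in>{1..n}. cmod (x i) < min \<epsilon> ((1 / 4) ^ n)" for x
  proof (intro conjI)
    have x\<epsilon>: "\<forall>i\<in>{1..n}. norm (x i) < \<epsilon>" using x by auto
    show "G_term n x summable_on multi_indices n"
      by (rule summable_on_G_term) (use x in auto)
    show "path_power_integrable n \<gamma> (S_integrand n x)"
      by (rule path_power_integrable_S_integrand[OF assms(2) B[OF x\<epsilon>]]) auto
    show "G n x = 1 / (2 * of_real pi * \<i>) ^ n * path_power_integral n \<gamma> (S_integrand n x)"
      by (simp add: eq[OF x\<epsilon>])
  qed
  moreover have "min \<epsilon> ((1 / 4) ^ n) > 0" using \<open>\<epsilon> > 0\<close> by simp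
  ultimately show ?thesis by blast
qed

end
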